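(* For each $n\ge 0$ write the rational number $c_n$ as $c_n=\dfrac{p_n}{q_n}$ with integers $p_n,q_n$, $q_n>0$ and $(p_n,q_n)=1$. Then $$q_n=2^{2n-b(n)}r_n,$$ where $r_n$ is odd and $b(n)$ is the number of non-zero digits in the binary expansion of $n$. In other words, the 2-adic norm of $c_n$ equals $|c_n|_2=2^{2n-b(n)}$. In particular, $c_n\ne 0$ for all $n\ge 0$.
   Context: $|\cdot|_2$ is the 2-adic norm on $\mathbb Q$ normalized by $|2|_2=1/2$. Let $\mathcal H=L^2([0,1],dx)$ (complex-valued functions, Lebesgue measure) with its norm $\|\cdot\|$. The sequence $(c_n)_{n\ge 0}$ is defined recursively: $c_0=1$, and, for each $n\ge 0$, the number $c_{n+1}$ is the unique complex number $c$ for which the norm $\|c_0+c_1x+\ldots+c_nx^n+c\,x^{n+1}\|$ is minimal among all $c\in\mathbb C$. Equivalently, $c_0=1$ and $\frac{c_0}{n+1}+\frac{c_1}{n+2}+\ldots+\frac{c_n}{2n+1}=0$ for all $n\ge 1$; in particular all $c_n$ are rational. *)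

theory Defs
  imports "HOL-Analysis.Analysis" "HOL-Computational_Algebra.Primes"
begin

(* Faithful for square-integrable functions only: the Bochner integral of a
   non-integrable function is 0. It is applied to polynomials. *)
definition L2_norm_unit :: "(real \<Rightarrow> complex) \<Rightarrow> real" where
  "L2_norm_unit f = sqrt (LINT x|lebesgue_on {0..1}. (cmod (f x))\<^sup>2)"

(* The description operator picks the unique minimizer. *)
fun min_coeff :: "nat \<Rightarrow> complex" where
  "min_coeff 0 = 1"
| "min_coeff (Suc n) =
     (THE c. \<forall>w.
        L2_norm_unit (\<lambda>x. (\<Sum>k\<le>n. min_coeff k * of_real x ^ k) + c * of_real x ^ Suc n)
        \<le> L2_norm_unit (\<lambda>x. (\<Sum>k\<le>n. min_coeff k * of_real x ^ k) + w * of_real x ^ Suc n))"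

definition binary_ones :: "nat \<Rightarrow> nat" where
  "binary_ones n = card {i. bit n i}"

(* Hence the natural-number subtraction 2 * n - binary_ones n never truncates. *)
lemma binary_ones_le: "binary_ones n \<le> n"
proof -
  have "{i. bit n i} \<subseteq> {..<n}"
  proof
    fix i assume "i \<in> {i. bit n i}"
    then have "n div 2 ^ i \<noteq> 0"
      by (auto simp: bit_iff_odd intro: ccontr)
    then have "2 ^ i \<le> n"
      by (meson div_less not_le)
    then show "i \<in> {..<n}"
      using less_le_trans[OF less_exp] by simp
  qed
  then show ?thesis
    unfolding binary_ones_def by (metis card_lessThan card_mono finite_lessThan)
qed

definition two_adic_norm :: "rat \<Rightarrow> real" where
  "two_adic_norm x =
     (if x = 0 then 0
      else let (a, b) = quotient_of x
           in 2 powi (int (multiplicity 2 b) - int (multiplicity 2 a)))"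

end

theory Submission
  imports Defs
begin

text \<open>
  Write \<open>b\<close> for \<open>binary_ones\<close> and \<open>v\<close> for the 2-adic valuation. Orthogonality of the minimizer to
  \<open>x ^ n\<close> gives \<open>c\<^sub>n = - (2 n + 1) * (\<Sum>k<n. c\<^sub>k / (n + k + 1))\<close>. By strong induction the
  valuation of the \<open>k\<close>-th summand is \<open>b k - 2 k - v (n + k + 1)\<close>. From
  \<open>b (m + 1) + v (m + 1) = b m + 1\<close> and the subadditivity of \<open>b\<close> it follows that this is
  \<open>b n - 2 n\<close> for \<open>k = n - 1\<close> and strictly larger for all smaller \<open>k\<close>, so the last summand
  determines the valuation of \<open>c\<^sub>n\<close>.
\<close>

section \<open>Binary digit sums and carries\<close>

lemma binary_ones_double: "binary_ones (2 * n) = binary_ones n"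
proof -
  have "{i. bit (2 * n) i} = Suc ` {i. bit n i}"
  proof (intro set_eqI)
    show "i \<in> {i. bit (2 * n) i} \<longleftrightarrow> i \<in> Suc ` {i. bit n i}" for i
      by (cases i) (auto simp: bit_0 bit_Suc)
  qed
  then show ?thesis
    unfolding binary_ones_def by (simp add: card_image)
qed

lemma finite_bits_nat: "finite {i. bit (n::nat) i}"
proof (rule finite_subset)
  show "{i. bit n i} \<subseteq> {..n}"
  proof
    fix i assume "i \<in> {i. bit n i}"
    then have "n div 2 ^ i \<noteq> 0"
      by (auto simp: bit_iff_odd intro: ccontr)
    then have "2 ^ i \<le> n"
      by (meson div_less not_le)
    then show "i \<in> {..n}"
      by (meson atMost_iff le_trans less_exp less_imp_le)
  qed
qed simp

lemma binary_ones_double_Suc: "binary_ones (Suc (2 * n)) = Suc (binary_ones n)"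
proof -
  have "{i. bit (Suc (2 * n)) i} = insert 0 (Suc ` {i. bit n i})"
  proof (intro set_eqI)
    show "i \<in> {i. bit (Suc (2 * n)) i} \<longleftrightarrow> i \<in> insert 0 (Suc ` {i. bit n i})" for i
      by (cases i) (auto simp: bit_0 bit_Suc)
  qed
  then show ?thesis
    unfolding binary_ones_def by (simp add: card_image finite_bits_nat)
qed

text \<open>Carrying: adding 1 turns the trailing block of ones of \<open>m\<close>, whose length is
  \<open>multiplicity 2 (Suc m)\<close>, into zeros and the zero above it into a one. The induction
  strips the last binary digit.\<close>

lemma binary_ones_Suc: "binary_ones (Suc m) + multiplicity 2 (Suc m) = Suc (binary_ones m)"
proof (induction m rule: less_induct)
  case (less m)
  show ?case
  proof (cases "even m")
    case True
    then obtain k where "m = 2 * k" ..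
    then show ?thesis
      by (simp add: binary_ones_double binary_ones_double_Suc not_dvd_imp_multiplicity_0)
  next
    case False
    then obtain k where k: "m = Suc (2 * k)"
      by (metis oddE Suc_eq_plus1)
    have Suc_m: "Suc m = 2 * Suc k"
      using k by simp
    have "multiplicity 2 (Suc m) = Suc (multiplicity 2 (Suc k))"
      unfolding Suc_m by (rule multiplicity_times_same) simp_all
    moreover have "binary_ones (Suc m) = binary_ones (Suc k)"
      unfolding Suc_m by (rule binary_ones_double)
    moreover have "binary_ones m = Suc (binary_ones k)"
      unfolding k by (rule binary_ones_double_Suc)
    ultimately show ?thesis
      using less.IH[of k] k by linarith
  qed
qed

text \<open>Induction on the last digits of both summands. Only two ones produce a carry; it adds at
  most one digit to \<open>i + j\<close>, while the two ones together count for two on the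
  right.\<close>

lemma binary_ones_add_le: "binary_ones (m + n) \<le> binary_ones m + binary_ones n"
proof (induction m arbitrary: n rule: less_induct)
  case (less m)
  have Suc_le: "binary_ones (Suc k) \<le> Suc (binary_ones k)" for k
    using binary_ones_Suc[of k] by linarith
  \<comment> \<open>\<open>m = 0\<close> stands apart because halving it does not give a smaller
    \<open>i\<close>.\<close>
  consider "m = 0" | i j where "m = 2 * i" "i < m" "n = 2 * j"
    | i j where "m = 2 * i" "i < m" "n = Suc (2 * j)"
    | i j where "m = Suc (2 * i)" "i < m" "n = 2 * j"
    | i j where "m = Suc (2 * i)" "i < m" "n = Suc (2 * j)"
    by (cases "even m"; cases "even n"; fastforce elim!: evenE oddE)
  then show ?case
  proof cases
    case 1
    then show ?thesis by simp
  next
    case 2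
    then have "m + n = 2 * (i + j)"
      by simp
    with 2 show ?thesis
      using less.IH[OF \<open>i < m\<close>, of j] by (simp only: binary_ones_double)
  next
    case 3
    then have "m + n = Suc (2 * (i + j))"
      by simp
    then have "binary_ones (m + n) = Suc (binary_ones (i + j))"
      by (simp only: binary_ones_double_Suc)
    moreover have "binary_ones m + binary_ones n = Suc (binary_ones i + binary_ones j)"
      using 3 by (simp only: binary_ones_double binary_ones_double_Suc add_Suc add_Suc_right)
    ultimately show ?thesis
      using less.IH[OF \<open>i < m\<close>, of j] by linarith
  next
    case 4
    then have "m + n = Suc (2 * (i + j))"
      by simp
    then have "binary_ones (m + n) = Suc (binary_ones (i + j))"
      by (simp only: binary_ones_double_Suc)
    moreover have "binary_ones m + binary_ones n = Suc (binary_ones i + binary_ones j)"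
      using 4 by (simp only: binary_ones_double binary_ones_double_Suc add_Suc add_Suc_right)
    ultimately show ?thesis
      using less.IH[OF \<open>i < m\<close>, of j] by linarith
  next
    case 5
    then have "m + n = 2 * Suc (i + j)"
      by simp
    then have "binary_ones (m + n) = binary_ones (Suc (i + j))"
      by (metis binary_ones_double)
    also have "\<dots> \<le> Suc (binary_ones i + binary_ones j)"
      using Suc_le[of "i + j"] less.IH[OF \<open>i < m\<close>, of j] by linarith
    finally show ?thesis
      using 5 by (simp add: binary_ones_double_Suc)
  qed
qed

text \<open>The summand \<open>k = n - 1\<close>: here \<open>n + k + 1\<close> is twice
  \<open>n\<close>, and the bound of the next lemma becomes an equality.\<close>

lemma binary_ones_dominant_term:
  "binary_ones (Suc k) + multiplicity 2 (Suc k + k + 1) = binary_ones k + 2"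
proof -
  have m: "Suc k + k + 1 = 2 * Suc k"
    by simp
  have "multiplicity 2 (Suc k + k + 1) = Suc (multiplicity 2 (Suc k))"
    unfolding m by (rule multiplicity_times_same) simp_all
  then show ?thesis
    using binary_ones_Suc[of k] by linarith
qed

text \<open>Rearranged, every summand before the last has valuation strictly above
  \<open>binary_ones n - 2 * n\<close>. If \<open>n - k\<close> is even, \<open>n + k + 1\<close> is
  odd and subadditivity suffices, as \<open>binary_ones (n - k)\<close> is at most
  \<open>n - k\<close>.\<close>

lemma binary_ones_other_terms:
  assumes "Suc k < n"
  shows "binary_ones n + multiplicity 2 (n + k + 1) < binary_ones k + 2 * (n - k)"
proof (cases "even (n - k)")
  case True
  then have "odd (n + k + 1)"
    using assms by (auto simp: even_diff_nat)
  moreover have "binary_ones n \<le> binary_ones k + binary_ones (n - k)"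
    using binary_ones_add_le[of k "n - k"] assms by simp
  ultimately show ?thesis
    using binary_ones_le[of "n - k"] assms by (simp add: not_dvd_imp_multiplicity_0)
next
  case False
  then obtain i where i: "n - k = 2 * i + 1"
    by (rule oddE)
  \<comment> \<open>\<open>Suc m\<close> is half of \<open>n + k + 1\<close>, so the increment
    formula trades its valuation for digit sums. Subadditivity along \<open>n = Suc m + i\<close>
    and \<open>m = k + i\<close> then bounds the left side by
    \<open>binary_ones k + 2 * i + 2\<close>, which is below
    \<open>binary_ones k + 4 * i + 2\<close> since \<open>i > 0\<close>.\<close>
  define m where "m = k + i"
  have n: "n = Suc m + i" and i0: "i > 0" and m: "n + k + 1 = 2 * Suc m"
    using i assms by (auto simp: m_def)
  have "multiplicity 2 (n + k + 1) = Suc (multiplicity 2 (Suc m))"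
    unfolding m by (rule multiplicity_times_same) simp_all
  moreover have "binary_ones n \<le> binary_ones (Suc m) + binary_ones i"
    unfolding n by (rule binary_ones_add_le)
  moreover have "binary_ones m \<le> binary_ones k + binary_ones i"
    unfolding m_def by (rule binary_ones_add_le)
  ultimately show ?thesis
    using binary_ones_Suc[of m] binary_ones_le[of i] i i0 by simp
qed

text \<open>The units and the maximal ideal of the localization of the integers at 2.\<close>

definition odd_frac :: "rat \<Rightarrow> bool" where
  "odd_frac x \<longleftrightarrow> (\<exists>a d. odd a \<and> odd d \<and> x = of_int a / of_int d)"

definition even_frac :: "rat \<Rightarrow> bool" where
  "even_frac x \<longleftrightarrow> (\<exists>a d. even a \<and> odd d \<and> x = of_int a / of_int d)"

lemma odd_frac_mult: "odd_frac x \<Longrightarrow> odd_frac y \<Longrightarrow> odd_frac (x * y)"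
  unfolding odd_frac_def by (metis even_mult_iff of_int_mult times_divide_times_eq)

lemma odd_frac_mult_even_frac: "odd_frac x \<Longrightarrow> even_frac y \<Longrightarrow> even_frac (x * y)"
  unfolding odd_frac_def even_frac_def
  by (metis even_mult_iff of_int_mult times_divide_times_eq)

lemma odd_frac_add_even_frac:
  assumes "odd_frac x" "even_frac y"
  shows "odd_frac (x + y)"
proof -
  obtain a d a' d' where *: "odd a" "odd d" "x = of_int a / of_int d"
    "even a'" "odd d'" "y = of_int a' / of_int d'"
    using assms unfolding odd_frac_def even_frac_def by blast
  then have "d \<noteq> 0" "d' \<noteq> 0"
    by auto
  then have "x + y = of_int (a * d' + a' * d) / of_int (d * d')"
    using * by (simp add: field_simps)
  with * show ?thesis
    unfolding odd_frac_def by (intro exI[of _ "a * d' + a' * d"] exI[of _ "d * d'"]) auto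
qed

lemma even_frac_add:
  assumes "even_frac x" "even_frac y"
  shows "even_frac (x + y)"
proof -
  obtain a d a' d' where *: "even a" "odd d" "x = of_int a / of_int d"
    "even a'" "odd d'" "y = of_int a' / of_int d'"
    using assms unfolding even_frac_def by blast
  then have "d \<noteq> 0" "d' \<noteq> 0"
    by auto
  then have "x + y = of_int (a * d' + a' * d) / of_int (d * d')"
    using * by (simp add: field_simps)
  with * show ?thesis
    unfolding even_frac_def by (intro exI[of _ "a * d' + a' * d"] exI[of _ "d * d'"]) auto
qed

lemma odd_frac_of_int: "odd a \<Longrightarrow> odd_frac (of_int a)"
  unfolding odd_frac_def by (metis div_by_1 odd_one of_int_1)

lemma even_frac_0: "even_frac 0"
  unfolding even_frac_def by (intro exI[of _ 0] exI[of _ 1]) simp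

lemma even_frac_sum: "(\<And>k. k \<in> A \<Longrightarrow> even_frac (f k)) \<Longrightarrow> even_frac (sum f A)"
  by (induction A rule: infinite_finite_induct) (auto simp: even_frac_0 even_frac_add)

text \<open>Cancelling the 2-part of \<open>m\<close> leaves an odd denominator. Equality in the
  hypothesis on \<open>e\<close> then yields a unit, strict inequality an element of the maximal
  ideal.\<close>

lemma two_power_div_odd_part:
  assumes "m > 0" "multiplicity 2 m \<le> e"
  obtains y :: int where "odd y"
    "(2 ^ e / of_nat m :: rat) = of_int (2 ^ (e - multiplicity 2 m)) / of_int y"
proof -
  obtain y where y: "m = 2 ^ multiplicity 2 m * y" "odd y"
    using multiplicity_decompose'[of m 2] assms by auto
  have "(of_nat m :: rat) = 2 ^ multiplicity 2 m * of_nat y"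
    by (subst y(1)) simp
  moreover have "(2::rat) ^ e = 2 ^ multiplicity 2 m * 2 ^ (e - multiplicity 2 m)"
    using assms(2) by (simp flip: power_add)
  ultimately have "(2 ^ e / of_nat m :: rat) = of_int (2 ^ (e - multiplicity 2 m)) / of_int (int y)"
    by simp
  with y(2) show ?thesis
    by (intro that[of "int y"]) auto
qed

lemma odd_frac_two_power_div:
  assumes "m > 0" "e = multiplicity 2 m"
  shows "odd_frac (2 ^ e / of_nat m)"
  using two_power_div_odd_part[of m e] assms unfolding odd_frac_def
  by (metis diff_self_eq_0 odd_one order_refl power_0)

lemma even_frac_two_power_div:
  assumes "m > 0" "multiplicity 2 m < e"
  shows "even_frac (2 ^ e / of_nat m)"
proof -
  have "even ((2::int) ^ (e - multiplicity 2 m))"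
    using assms by simp
  then show ?thesis
    using two_power_div_odd_part[of m e] assms unfolding even_frac_def
    by (metis less_imp_le)
qed

section \<open>The rational recursion and the valuation of its terms\<close>

fun rat_coeff :: "nat \<Rightarrow> rat" where
  "rat_coeff 0 = 1"
| "rat_coeff (Suc n) = - of_nat (2 * n + 3) * (\<Sum>k\<le>n. rat_coeff k / of_nat (Suc n + k + 1))"

declare rat_coeff.simps(2)[simp del]

text \<open>This encodes that \<open>rat_coeff n\<close> has valuation
  \<open>binary_ones n - 2 * n\<close>. After scaling, the last summand is a unit and the others lie
  in the maximal ideal, so their sum is a unit; the prefactor is odd.\<close>

lemma odd_frac_rat_coeff: "odd_frac (rat_coeff n * 2 ^ (2 * n - binary_ones n))"
proof (induction n rule: less_induct)
  case (less n)
  show ?case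
  proof (cases n)
    case 0
    then show ?thesis
      using odd_frac_of_int[of 1] by simp
  next
    case (Suc m)
    define u where "u k = rat_coeff k * 2 ^ (2 * k - binary_ones k)" for k
    \<comment> \<open>\<open>e k\<close> is the power of two that remains when the scaling factor
      for \<open>n\<close> has paid for the one that makes \<open>rat_coeff k\<close> a
      unit.\<close>
    define e where "e k = 2 * (n - k) + binary_ones k - binary_ones n" for k
    define t where "t k = u k * (2 ^ e k / of_nat (n + k + 1))" for k
    have u: "odd_frac (u k)" if "k < n" for k
      using less.IH[OF that] by (simp add: u_def)
    have term_eq: "rat_coeff k / of_nat (n + k + 1) * 2 ^ (2 * n - binary_ones n) = t k"
      if "k < n" for k
    proof -
      \<comment> \<open>This bound ensures that the subtraction in \<open>e k\<close> does not
        truncate.\<close>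
      have "binary_ones n \<le> binary_ones k + 2 * (n - k)"
        using binary_ones_add_le[of k "n - k"] binary_ones_le[of "n - k"] that by simp
      then have "2 * n - binary_ones n = (2 * k - binary_ones k) + e k"
        unfolding e_def using binary_ones_le[of k] that by simp
      then show ?thesis
        by (simp add: t_def u_def power_add)
    qed
    have "odd_frac (t m)"
      unfolding t_def
    proof (intro odd_frac_mult u odd_frac_two_power_div)
      show "e m = multiplicity 2 (n + m + 1)"
        using binary_ones_dominant_term[of m] by (simp add: e_def Suc)
    qed (use Suc in auto)
    moreover have "even_frac (\<Sum>k<m. t k)"
    proof (rule even_frac_sum)
      fix k assume "k \<in> {..<m}"
      then have k: "Suc k < n"
        using Suc by simp
      show "even_frac (t k)"
        unfolding t_def
      proof (intro odd_frac_mult_even_frac u even_frac_two_power_div)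
        show "multiplicity 2 (n + k + 1) < e k"
          using binary_ones_other_terms[OF k] unfolding e_def by simp
      qed (use k in auto)
    qed
    ultimately have "odd_frac (t m + (\<Sum>k<m. t k))"
      by (rule odd_frac_add_even_frac)
    then have "odd_frac (of_int (- int (2 * m + 3)) * (t m + (\<Sum>k<m. t k)))"
      by (intro odd_frac_mult odd_frac_of_int) auto
    also have "of_int (- int (2 * m + 3)) * (t m + (\<Sum>k<m. t k))
        = - of_nat (2 * m + 3) * (\<Sum>k\<le>m. t k)"
      by (simp add: add.commute flip: lessThan_Suc_atMost)
    also have "(\<Sum>k\<le>m. t k)
        = (\<Sum>k\<le>m. rat_coeff k / of_nat (n + k + 1)) * 2 ^ (2 * n - binary_ones n)"
      unfolding sum_distrib_right by (intro sum.cong refl term_eq[symmetric]) (use Suc in auto)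
    finally show ?thesis
      by (simp add: Suc rat_coeff.simps(2) mult.assoc)
  qed
qed

section \<open>Solving the minimization problem in L2\<close>

lemma integral_unit_interval_power:
  "(LINT x|lebesgue_on {0..1}. x ^ n) = 1 / real (Suc n)"
proof -
  have "integrable (lebesgue_on {0..1}) (\<lambda>x::real. x ^ n)"
    by (intro continuous_imp_integrable_real continuous_intros)
  then have "(LINT x|lebesgue_on {0..1}. x ^ n) = integral {0..1} (\<lambda>x::real. x ^ n)"
    by (rule lebesgue_integral_eq_integral) simp
  also have "integral {0..1} (\<lambda>x::real. x ^ n) = 1 / real (Suc n)"
  proof (rule integral_unique)
    have "((\<lambda>x::real. x ^ Suc n / real (Suc n)) has_vector_derivative x ^ n) (at x within {0..1})" for x
      unfolding has_real_derivative_iff_has_vector_derivative[symmetric]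
      by (rule derivative_eq_intros refl | simp)+
    then show "((\<lambda>x::real. x ^ n) has_integral 1 / real (Suc n)) {0..1}"
      using fundamental_theorem_of_calculus[of 0 1 "\<lambda>x. x ^ Suc n / real (Suc n)" "\<lambda>x. x ^ n"]
      by simp
  qed
  finally show ?thesis .
qed

text \<open>Completing the square in \<open>w\<close>: the squared norm is
  \<open>A + 2 * Re w * B\<close> plus the squared modulus of \<open>w\<close> over
  \<open>2 * m + 1\<close>, the reciprocal of that number being the integral of
  \<open>x ^ (2 * m)\<close>. The minimizer can be read off.\<close>

lemma L2_norm_unit_add_monomial:
  fixes P :: "real \<Rightarrow> real" and w :: complex and m :: nat
  assumes P: "continuous_on {0..1} P"
  defines "A \<equiv> (LINT x|lebesgue_on {0..1}. (P x)\<^sup>2)"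
    and "B \<equiv> (LINT x|lebesgue_on {0..1}. P x * x ^ m)"
  shows "L2_norm_unit (\<lambda>x. of_real (P x) + w * of_real x ^ m)
    = sqrt (A - real (2 * m + 1) * B\<^sup>2
        + (cmod (w - of_real (- real (2 * m + 1) * B)))\<^sup>2 / real (2 * m + 1))"
proof -
  define D where "D = real (2 * m + 1)"
  have D: "D > 0"
    by (simp add: D_def)
  have *: "(cmod (of_real (P x) + w * of_real x ^ m))\<^sup>2
      = (P x)\<^sup>2 + 2 * Re w * (P x * x ^ m) + (cmod w)\<^sup>2 * x ^ (2 * m)" for x
    unfolding cmod_power2
    by (simp add: power_mult power2_eq_square algebra_simps flip: of_real_power)
  have i: "integrable (lebesgue_on {0..1}) (\<lambda>x. (P x)\<^sup>2)"
      "integrable (lebesgue_on {0..1}) (\<lambda>x. P x * x ^ m)"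
      "integrable (lebesgue_on {0..1}) (\<lambda>x::real. x ^ (2 * m))"
    by (intro continuous_imp_integrable_real continuous_intros P)+
  have "(LINT x|lebesgue_on {0..1}. (cmod (of_real (P x) + w * of_real x ^ m))\<^sup>2)
      = A + 2 * Re w * B + (cmod w)\<^sup>2 * (1 / D)"
    unfolding * A_def B_def D_def using i integral_unit_interval_power[of "2 * m"]
    by (simp add: add.commute)
  also have "\<dots> = A - D * B\<^sup>2 + (cmod (w - of_real (- D * B)))\<^sup>2 / D"
    using D unfolding cmod_power2 by (simp add: field_simps power2_eq_square)
  finally show ?thesis
    unfolding L2_norm_unit_def D_def by simp
qed

lemma of_real_of_rat: "(of_real (of_rat r) :: 'a :: {real_div_algebra, field_char_0}) = of_rat r"
proof -
  obtain a b where r: "r = of_int a / of_int b"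
    using quotient_of_div[of r] by (cases "quotient_of r") auto
  show ?thesis
    unfolding r of_rat_divide of_rat_of_int_eq of_real_divide of_real_of_int_eq ..
qed

text \<open>By induction the polynomial built so far has real coefficients, so the completed square
  applies. Its minimizer \<open>c\<close> is, after termwise integration, the right side of the
  rational recursion.\<close>

lemma min_coeff_eq_rat_coeff: "min_coeff n = of_rat (rat_coeff n)"
proof (induction n rule: less_induct)
  case (less n)
  show ?case
  proof (cases n)
    case 0
    then show ?thesis by simp
  next
    case (Suc m)
    define P where "P x = (\<Sum>k\<le>m. of_rat (rat_coeff k) * x ^ k)" for x :: real
    define B where "B = (LINT x|lebesgue_on {0..1}. P x * x ^ n)"
    define c where "c = complex_of_real (- real (2 * n + 1) * B)"
    define N where
      "N w = L2_norm_unit (\<lambda>x. (\<Sum>k\<le>m. min_coeff k * of_real x ^ k) + w * of_real x ^ n)" for w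
    have P: "(\<Sum>k\<le>m. min_coeff k * of_real x ^ k) = of_real (P x)" for x
    proof -
      have "complex_of_real (P x) = (\<Sum>k\<le>m. of_real (of_rat (rat_coeff k)) * of_real x ^ k)"
        by (simp add: P_def)
      also have "\<dots> = (\<Sum>k\<le>m. min_coeff k * of_real x ^ k)"
        by (intro sum.cong refl) (simp add: less.IH Suc of_real_of_rat)
      finally show ?thesis ..
    qed
    have cont: "continuous_on {0..1} P"
      unfolding P_def by (intro continuous_intros)
    \<comment> \<open>The two radicands differ only in the squared distance to \<open>c\<close>, so
      minimizing \<open>N\<close> means minimizing that distance. This makes the minimizer unique
      and the description operator meaningful.\<close>
    have N_le: "N w \<le> N w' \<longleftrightarrow> cmod (w - c) \<le> cmod (w' - c)" for w w'
      unfolding N_def P L2_norm_unit_add_monomial[OF cont] B_def[symmetric] c_def[symmetric]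
      by (simp add: divide_le_cancel flip: abs_le_square_iff)
    have "min_coeff n = (THE w. \<forall>w'. N w \<le> N w')"
      unfolding N_def Suc by simp
    also have "\<dots> = c"
      unfolding N_le
    proof (rule the_equality)
      show "\<forall>w'. cmod (c - c) \<le> cmod (w' - c)"
        by simp
      show "w = c" if "\<forall>w'. cmod (w - c) \<le> cmod (w' - c)" for w
        using that[rule_format, of c] by simp
    qed
    finally have min_coeff: "min_coeff n = c" .
    have "B = (LINT x|lebesgue_on {0..1}. (\<Sum>k\<le>m. of_rat (rat_coeff k) * x ^ (n + k)))"
      unfolding B_def P_def by (simp add: sum_distrib_left power_add mult_ac)
    also have "\<dots> = (\<Sum>k\<le>m. (LINT x|lebesgue_on {0..1}. of_rat (rat_coeff k) * x ^ (n + k)))"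
      by (intro Bochner_Integration.integral_sum continuous_imp_integrable_real continuous_intros)
    finally have "B = of_rat (\<Sum>k\<le>m. rat_coeff k / of_nat (n + k + 1))"
      by (simp add: integral_unit_interval_power of_rat_sum of_rat_divide of_rat_add)
    then have "c = of_real (of_rat (- of_nat (2 * n + 1) * (\<Sum>k\<le>m. rat_coeff k / of_nat (n + k + 1))))"
      unfolding c_def of_rat_mult of_rat_minus of_rat_of_nat_eq by simp
    also have "- of_nat (2 * n + 1) * (\<Sum>k\<le>m. rat_coeff k / of_nat (n + k + 1)) = rat_coeff n"
      unfolding Suc rat_coeff.simps(2) by (simp add: algebra_simps)
    finally show ?thesis
      unfolding min_coeff of_real_of_rat .
  qed
qed

section \<open>Passing to the reduced fraction\<close>

lemma quotient_of_odd_frac: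
  assumes "odd_frac (x * 2 ^ e)" and pq: "quotient_of x = (p, q)"
  shows "odd p" "multiplicity 2 q = e"
proof -
  obtain a d where ad: "odd a" "odd d" "x * 2 ^ e = of_int a / of_int d"
    using assms unfolding odd_frac_def by blast
  have q: "q > 0" and cop: "coprime p q" and x: "x = of_int p / of_int q"
    using pq quotient_of_denom_pos quotient_of_coprime quotient_of_div by auto
  have "d \<noteq> 0"
    using ad by auto
  then have "(of_int (p * d * 2 ^ e) :: rat) = of_int (a * q)"
    using ad(3) q unfolding x by (simp add: field_simps)
  then have eq: "p * d * 2 ^ e = a * q"
    by (simp only: of_int_eq_iff)
  \<comment> \<open>If \<open>p\<close> were even, \<open>q\<close> would be odd by coprimality,
    making \<open>a * q\<close> odd although it equals an even product.\<close>
  show p: "odd p"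
  proof
    assume "even p"
    then have "odd q"
      using cop coprime_common_divisor[of p q 2] by auto
    moreover have "even (a * q)"
      using \<open>even p\<close> by (simp flip: eq)
    ultimately show False
      using ad by simp
  qed
  have "multiplicity 2 (p * d * 2 ^ e) = e"
    using p ad(2) multiplicity_prime_elem_times_other[of 2 "p * d" "2 ^ e"]
    by (auto simp: prime_elem_multiplicity_mult_distrib multiplicity_same_power not_dvd_imp_multiplicity_0
        dest: arg_cong[of _ 0 even])
  moreover have "multiplicity 2 (a * q) = multiplicity 2 q"
    using multiplicity_prime_elem_times_other[of 2 a q] ad by simp
  ultimately show "multiplicity 2 q = e"
    using eq by simp
qed

theorem proposition2:
  fixes n :: nat
  shows "(\<exists>p q r :: int. q > 0 \<and> coprime p q \<and> min_coeff n = of_int p / of_int q \<and>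
            odd r \<and> q = 2 ^ (2 * n - binary_ones n) * r)
       \<and> (\<exists>x :: rat. min_coeff n = of_rat x \<and>
            two_adic_norm x = 2 powi (2 * int n - int (binary_ones n)))
       \<and> min_coeff n \<noteq> 0"
proof -
  define x e where "x = rat_coeff n" and "e = 2 * n - binary_ones n"
  obtain p q where pq: "quotient_of x = (p, q)"
    by fastforce
  have p: "odd p" and q: "multiplicity 2 q = e"
    using quotient_of_odd_frac[OF _ pq, of e] odd_frac_rat_coeff[of n] by (auto simp: x_def e_def)
  have q0: "q > 0" and cop: "coprime p q" and x: "x = of_int p / of_int q"
    using pq quotient_of_denom_pos quotient_of_coprime quotient_of_div by auto
  have min_coeff: "min_coeff n = of_rat x"
    by (simp add: min_coeff_eq_rat_coeff x_def)
  obtain r where r: "q = 2 ^ e * r" "odd r"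
    using multiplicity_decompose'[of q 2] q0 q by auto
  have "x \<noteq> 0"
    using p q0 by (auto simp: x)
  have e: "2 * int n - int (binary_ones n) = int e"
    using binary_ones_le[of n] by (simp add: e_def)
  \<comment> \<open>The odd numerator contributes nothing, so the exponent is the multiplicity
    \<open>e\<close> of 2 in the denominator.\<close>
  have "two_adic_norm x = 2 powi (2 * int n - int (binary_ones n))"
    unfolding e using p q pq \<open>x \<noteq> 0\<close> by (simp add: two_adic_norm_def not_dvd_imp_multiplicity_0)
  moreover have "min_coeff n = of_int p / of_int q"
    by (simp add: min_coeff x of_rat_divide)
  moreover have "min_coeff n \<noteq> 0"
    using \<open>x \<noteq> 0\<close> by (simp add: min_coeff)
  ultimately show ?thesis
    using q0 cop r min_coeff unfolding e_def by blast
qed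

end
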